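(* Let $G$ be a group, $M=G^0=G\sqcup\{0\}$ the monoid obtained from $G$ by adjoining a zero element, and $\alpha$ a strong partial action of $M$ on a semigroup $X$ such that $\operatorname{dom}\alpha_g$ is an ideal of $X$ for all $g\in G$. If $\alpha$ is globalizable (in the category of semigroups), then both of the following conditions hold: (LC1) for all $g\in G$ and $x,y,z\in X$ with $y\in\operatorname{dom}\alpha_g$: $\alpha_{g^{-1}}(\alpha_g(xy)z)=x\,\alpha_{g^{-1}}(\alpha_g(y)z)$; (LC2) for all $m\in M$, $y\in\operatorname{dom}\alpha_m$ and $x,z\in X^1$: if $xyz\in\operatorname{dom}\alpha_0$, then $x\alpha_m(y)z\in\operatorname{dom}\alpha_0$ and $\alpha_0(xyz)=\alpha_0(x\alpha_m(y)z)$.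
   Context: Let $M$ be a monoid with identity $e$. A strong partial action of $M$ on a set $X$ is a family $\alpha=\{\alpha_m:\operatorname{dom}\alpha_m\to X\}_{m\in M}$ of maps with $\operatorname{dom}\alpha_m\subseteq X$ such that: (1) $\operatorname{dom}\alpha_e=X$ and $\alpha_e=\mathrm{id}_X$; (2) $\alpha_m^{-1}(\operatorname{dom}\alpha_n)=\operatorname{dom}\alpha_{nm}\cap\operatorname{dom}\alpha_m$ for all $m,n\in M$; (3) $\alpha_n\circ\alpha_m=\alpha_{nm}$ on $\alpha_m^{-1}(\operatorname{dom}\alpha_n)$ for all $m,n\in M$. It is a global action if $\operatorname{dom}\alpha_m=X$ for all $m$. A strong partial action (global action) of $M$ on a semigroup $X$ is one on the underlying set such that each $\operatorname{dom}\alpha_m$ is a subsemigroup of $X$ and each $\alpha_m$ is a semigroup homomorphism. Ideals are two-sided; subsemigroups and ideals are allowed to be empty. $X^1$ denotes the semigroup $X$ with an identity element $1$ adjoined. If $\alpha$ is a strong partial action of $M$ on a semigroup $X$ and $\beta$ is a global action of $M$ on a semigroup $Y$, a morphism $\iota:\alpha\to\beta$ is a semigroup homomorphism $\iota:X\to Y$ with $\beta_m(\iota(x))=\iota(\alpha_m(x))$ for all $m\in M$, $x\in\operatorname{dom}\alpha_m$. A globalization of $\alpha$ is a pair $(\beta,\iota)$, with $\beta$ a global action of $M$ on a semigroup and $\iota:\alpha\to\beta$ a morphism, such that for all $x,y\in X$ and $m\in M$ with $\beta_m(\iota(x))=\iota(y)$ one has $x\in\operatorname{dom}\alpha_m$ and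 $\alpha_m(x)=y$. $\alpha$ is globalizable if it has a globalization. *)

theory Defs
  imports "HOL-Algebra.Group"
begin

(* HOL-Algebra has no record for semigroups. A semigroup is represented by a monoid record of
   which only carrier and mult are used; nothing is assumed about the field one. The carrier may
   be empty. Homomorphisms of semigroups are then the library's hom. *)

definition sgroup :: "('x, 'b) monoid_scheme \<Rightarrow> bool" where
  "sgroup X \<longleftrightarrow>
     (\<forall>x\<in>carrier X. \<forall>y\<in>carrier X. x \<otimes>\<^bsub>X\<^esub> y \<in> carrier X) \<and>
     (\<forall>x\<in>carrier X. \<forall>y\<in>carrier X. \<forall>z\<in>carrier X.
        (x \<otimes>\<^bsub>X\<^esub> y) \<otimes>\<^bsub>X\<^esub> z = x \<otimes>\<^bsub>X\<^esub> (y \<otimes>\<^bsub>X\<^esub> z))"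

definition subsemigroup :: "'x set \<Rightarrow> ('x, 'b) monoid_scheme \<Rightarrow> bool" where
  "subsemigroup H X \<longleftrightarrow> H \<subseteq> carrier X \<and> (\<forall>a\<in>H. \<forall>b\<in>H. a \<otimes>\<^bsub>X\<^esub> b \<in> H)"

definition semigroup_ideal :: "'x set \<Rightarrow> ('x, 'b) monoid_scheme \<Rightarrow> bool" where
  "semigroup_ideal I X \<longleftrightarrow> I \<subseteq> carrier X \<and>
     (\<forall>a\<in>I. \<forall>x\<in>carrier X. x \<otimes>\<^bsub>X\<^esub> a \<in> I \<and> a \<otimes>\<^bsub>X\<^esub> x \<in> I)"

(* None is the adjoined identity; it is new even if X already has an identity. *)
definition adjoin_one :: "('x, 'b) monoid_scheme \<Rightarrow> 'x option monoid" where
  "adjoin_one X =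
     \<lparr>carrier = insert None (Some ` carrier X),
      mult = (\<lambda>a b. case a of None \<Rightarrow> b
                | Some x \<Rightarrow> (case b of None \<Rightarrow> Some x | Some y \<Rightarrow> Some (x \<otimes>\<^bsub>X\<^esub> y))),
      one = None\<rparr>"

(* None is the adjoined zero. *)
definition adjoin_zero :: "('g, 'b) monoid_scheme \<Rightarrow> 'g option monoid" where
  "adjoin_zero G =
     \<lparr>carrier = insert None (Some ` carrier G),
      mult = (\<lambda>a b. case a of None \<Rightarrow> None
                | Some g \<Rightarrow> (case b of None \<Rightarrow> None | Some h \<Rightarrow> Some (g \<otimes>\<^bsub>G\<^esub> h))),
      one = Some \<one>\<^bsub>G\<^esub>\<rparr>"

lemma adjoin_one_monoid: "sgroup X \<Longrightarrow> monoid (adjoin_one X)"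
  by (rule monoidI) (auto simp: adjoin_one_def sgroup_def)

lemma (in monoid) adjoin_zero_monoid: "monoid (adjoin_zero G)"
  by (rule monoidI) (auto simp: adjoin_zero_def m_assoc)

(* A family of partial maps is given by its domains D m together with total functions
   \<alpha> m, whose values outside D m are irrelevant. *)
locale strong_partial_action = monoid M for M :: "('m, 'c) monoid_scheme" (structure) +
  fixes S :: "'x set" and D :: "'m \<Rightarrow> 'x set" and \<alpha> :: "'m \<Rightarrow> 'x \<Rightarrow> 'x"
  assumes dom_subset: "m \<in> carrier M \<Longrightarrow> D m \<subseteq> S"
    and maps_to: "\<lbrakk>m \<in> carrier M; x \<in> D m\<rbrakk> \<Longrightarrow> \<alpha> m x \<in> S"
    and dom_one: "D \<one> = S"
    and act_one: "x \<in> S \<Longrightarrow> \<alpha> \<one> x = x"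
    and dom_mult: "\<lbrakk>m \<in> carrier M; n \<in> carrier M\<rbrakk> \<Longrightarrow>
      {x \<in> D m. \<alpha> m x \<in> D n} = D (n \<otimes> m) \<inter> D m"
    and act_mult: "\<lbrakk>m \<in> carrier M; n \<in> carrier M; x \<in> D m; \<alpha> m x \<in> D n\<rbrakk> \<Longrightarrow>
      \<alpha> n (\<alpha> m x) = \<alpha> (n \<otimes> m) x"

locale semigroup_strong_partial_action =
  strong_partial_action M "carrier X" D \<alpha>
  for M :: "('m, 'c) monoid_scheme" (structure) and X :: "('x, 'b) monoid_scheme"
    and D :: "'m \<Rightarrow> 'x set" and \<alpha> :: "'m \<Rightarrow> 'x \<Rightarrow> 'x" +
  assumes semigroup_space: "sgroup X"
    and dom_subsemigroup: "m \<in> carrier M \<Longrightarrow> subsemigroup (D m) X"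
    and act_hom: "m \<in> carrier M \<Longrightarrow> \<alpha> m \<in> hom (X\<lparr>carrier := D m\<rparr>) X"

definition semigroup_global_action ::
  "('m, 'c) monoid_scheme \<Rightarrow> ('y, 'd) monoid_scheme \<Rightarrow> ('m \<Rightarrow> 'y \<Rightarrow> 'y) \<Rightarrow> bool" where
  "semigroup_global_action M Y \<beta> \<longleftrightarrow> semigroup_strong_partial_action M Y (\<lambda>_. carrier Y) \<beta>"

definition action_morphism ::
  "('m, 'c) monoid_scheme \<Rightarrow> ('x, 'b) monoid_scheme \<Rightarrow> ('m \<Rightarrow> 'x set) \<Rightarrow> ('m \<Rightarrow> 'x \<Rightarrow> 'x) \<Rightarrow>
   ('y, 'd) monoid_scheme \<Rightarrow> ('m \<Rightarrow> 'y \<Rightarrow> 'y) \<Rightarrow> ('x \<Rightarrow> 'y) \<Rightarrow> bool" where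
  "action_morphism M X D \<alpha> Y \<beta> \<iota> \<longleftrightarrow>
     \<iota> \<in> hom X Y \<and> (\<forall>m\<in>carrier M. \<forall>x\<in>D m. \<beta> m (\<iota> x) = \<iota> (\<alpha> m x))"

definition globalization ::
  "('m, 'c) monoid_scheme \<Rightarrow> ('x, 'b) monoid_scheme \<Rightarrow> ('m \<Rightarrow> 'x set) \<Rightarrow> ('m \<Rightarrow> 'x \<Rightarrow> 'x) \<Rightarrow>
   ('y, 'd) monoid_scheme \<Rightarrow> ('m \<Rightarrow> 'y \<Rightarrow> 'y) \<Rightarrow> ('x \<Rightarrow> 'y) \<Rightarrow> bool" where
  "globalization M X D \<alpha> Y \<beta> \<iota> \<longleftrightarrow>
     semigroup_global_action M Y \<beta> \<and> action_morphism M X D \<alpha> Y \<beta> \<iota> \<and>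
     (\<forall>m\<in>carrier M. \<forall>x\<in>carrier X. \<forall>y\<in>carrier X.
        \<beta> m (\<iota> x) = \<iota> y \<longrightarrow> x \<in> D m \<and> \<alpha> m x = y)"

(* HOL cannot quantify over types, so the type of the elements of the globalizing semigroup is a
   parameter. In a theorem that has globalizable TYPE('y) as a hypothesis with 'y a type variable,
   the globalization may live on any type. *)
definition globalizable ::
  "'y itself \<Rightarrow> ('m, 'c) monoid_scheme \<Rightarrow> ('x, 'b) monoid_scheme \<Rightarrow>
   ('m \<Rightarrow> 'x set) \<Rightarrow> ('m \<Rightarrow> 'x \<Rightarrow> 'x) \<Rightarrow> bool" where
  "globalizable _ M X D \<alpha> \<longleftrightarrow> (\<exists>(Y :: 'y monoid) \<beta> \<iota>. globalization M X D \<alpha> Y \<beta> \<iota>)"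

(* In LC1 the two sides are defined in the sense of partial maps as soon as all D (Some g) are
   ideals: \<alpha> g maps D g into D (inv g) by the axiom dom_mult, which is closed under
   multiplication by elements of X. *)
definition LC1 ::
  "('g, 'c) monoid_scheme \<Rightarrow> ('x, 'b) monoid_scheme \<Rightarrow>
   ('g option \<Rightarrow> 'x set) \<Rightarrow> ('g option \<Rightarrow> 'x \<Rightarrow> 'x) \<Rightarrow> bool" where
  "LC1 G X D \<alpha> \<longleftrightarrow>
     (\<forall>g\<in>carrier G. \<forall>x\<in>carrier X. \<forall>y\<in>D (Some g). \<forall>z\<in>carrier X.
        \<alpha> (Some (inv\<^bsub>G\<^esub> g)) (\<alpha> (Some g) (x \<otimes>\<^bsub>X\<^esub> y) \<otimes>\<^bsub>X\<^esub> z) =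
        x \<otimes>\<^bsub>X\<^esub> \<alpha> (Some (inv\<^bsub>G\<^esub> g)) (\<alpha> (Some g) y \<otimes>\<^bsub>X\<^esub> z))"

(* u is the element x y z of X, computed in the semigroup with adjoined identity (where elements
   of X carry the tag Some), and v is x (\<alpha> m y) z. Index None is the zero of the acting monoid. *)
definition LC2 ::
  "('g, 'c) monoid_scheme \<Rightarrow> ('x, 'b) monoid_scheme \<Rightarrow>
   ('g option \<Rightarrow> 'x set) \<Rightarrow> ('g option \<Rightarrow> 'x \<Rightarrow> 'x) \<Rightarrow> bool" where
  "LC2 G X D \<alpha> \<longleftrightarrow>
     (\<forall>m\<in>carrier (adjoin_zero G). \<forall>y\<in>D m.
      \<forall>x\<in>carrier (adjoin_one X). \<forall>z\<in>carrier (adjoin_one X). \<forall>u\<in>D None.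
        x \<otimes>\<^bsub>adjoin_one X\<^esub> Some y \<otimes>\<^bsub>adjoin_one X\<^esub> z = Some u \<longrightarrow>
        (\<exists>v\<in>D None. x \<otimes>\<^bsub>adjoin_one X\<^esub> Some (\<alpha> m y) \<otimes>\<^bsub>adjoin_one X\<^esub> z = Some v \<and>
                    \<alpha> None u = \<alpha> None v))"

end

theory Submission
  imports Defs
begin

(* Let \<iota> be the embedding into the globalizing action \<beta>. Both sides of LC1 have the image
   \<iota> x * \<iota> y * \<beta> (inv g) (\<iota> z), and \<iota> is injective. For LC2, \<beta> 0 \<circ> \<beta> m = \<beta> 0 shows that
   \<beta> 0 \<circ> \<iota> is a homomorphism that does not distinguish y from \<alpha> m y; hence it takes the value
   \<iota> (\<alpha> 0 (x y z)), which lies in the image of \<iota>, at x (\<alpha> m y) z as well, and the defining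
   property of a globalization returns the claim about \<alpha> 0. *)

lemma sgroup_closed: "\<lbrakk>sgroup X; x \<in> carrier X; y \<in> carrier X\<rbrakk> \<Longrightarrow> x \<otimes>\<^bsub>X\<^esub> y \<in> carrier X"
  unfolding sgroup_def by blast

lemma sgroup_assoc:
  "\<lbrakk>sgroup X; x \<in> carrier X; y \<in> carrier X; z \<in> carrier X\<rbrakk> \<Longrightarrow>
    (x \<otimes>\<^bsub>X\<^esub> y) \<otimes>\<^bsub>X\<^esub> z = x \<otimes>\<^bsub>X\<^esub> (y \<otimes>\<^bsub>X\<^esub> z)"
  unfolding sgroup_def by blast

context
  fixes M :: "('m, 'c) monoid_scheme" (structure)
    and X :: "('x, 'b) monoid_scheme" and Y :: "('y, 'd) monoid_scheme"
    and D \<alpha> \<beta> \<iota>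
  assumes spa: "semigroup_strong_partial_action M X D \<alpha>"
    and glob: "globalization M X D \<alpha> Y \<beta> \<iota>"
begin

interpretation P: semigroup_strong_partial_action M X D \<alpha>
  by (fact spa)

interpretation Q: semigroup_strong_partial_action M Y "\<lambda>_. carrier Y" \<beta>
  using glob by (simp add: globalization_def semigroup_global_action_def)

lemma globalization_hom: "\<iota> \<in> hom X Y"
  and globalization_equivariant: "\<lbrakk>m \<in> carrier M; x \<in> D m\<rbrakk> \<Longrightarrow> \<iota> (\<alpha> m x) = \<beta> m (\<iota> x)"
  and globalization_reflects:
    "\<lbrakk>m \<in> carrier M; x \<in> carrier X; y \<in> carrier X; \<beta> m (\<iota> x) = \<iota> y\<rbrakk> \<Longrightarrow> x \<in> D m \<and> \<alpha> m x = y"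
  using glob unfolding globalization_def action_morphism_def by metis+

text \<open>The reflecting property at m = \<open>\<one>\<close>, where both actions are the
  identity.\<close>

lemma globalization_inj: "inj_on \<iota> (carrier X)"
proof (rule inj_onI)
  fix x y assume xy: "x \<in> carrier X" "y \<in> carrier X" and eq: "\<iota> x = \<iota> y"
  have "\<beta> \<one> (\<iota> x) = \<iota> y"
    unfolding eq[symmetric] by (rule Q.act_one[OF hom_in_carrier[OF globalization_hom xy(1)]])
  then show "x = y"
    using globalization_reflects[OF P.one_closed xy] P.act_one[OF xy(1)] by metis
qed

text \<open>Works in any acting monoid, with the left inverse \<open>h\<close> of \<open>g\<close>
  in the role of \<open>inv g\<close>. The ideal conditions put all arguments of
  \<open>\<alpha> g\<close> and \<open>\<alpha> h\<close> into their domains, so that both sides can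
  be pushed through \<open>\<iota>\<close>.\<close>

lemma globalizable_LC1:
  assumes g: "g \<in> carrier M" and h: "h \<in> carrier M" and hg: "h \<otimes> g = \<one>"
    and Dg: "semigroup_ideal (D g) X" and Dh: "semigroup_ideal (D h) X"
    and x: "x \<in> carrier X" and y: "y \<in> D g" and z: "z \<in> carrier X"
  shows "\<alpha> h (\<alpha> g (x \<otimes>\<^bsub>X\<^esub> y) \<otimes>\<^bsub>X\<^esub> z) = x \<otimes>\<^bsub>X\<^esub> \<alpha> h (\<alpha> g y \<otimes>\<^bsub>X\<^esub> z)"
proof -
  note X_closed = sgroup_closed[OF P.semigroup_space]
  note Y_assoc = sgroup_assoc[OF Q.semigroup_space]
  have \<beta>h: "\<beta> h (a \<otimes>\<^bsub>Y\<^esub> b) = \<beta> h a \<otimes>\<^bsub>Y\<^esub> \<beta> h b" if "a \<in> carrier Y" "b \<in> carrier Y" for a b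
    using Q.act_hom[OF h] that by (simp add: hom_mult)
  have \<beta>hg: "\<beta> h (\<beta> g a) = a" if "a \<in> carrier Y" for a
    using Q.act_mult[OF g h that] Q.maps_to[OF g that] Q.act_one[OF that] hg by simp
  note \<iota>_in = hom_in_carrier[OF globalization_hom]
  note \<iota>_mult = hom_mult[OF globalization_hom]
  have y_in: "y \<in> carrier X"
    using y P.dom_subset[OF g] by blast
  \<comment> \<open>Since \<open>h \<otimes> g = \<one>\<close> has all of X as its domain,
    \<open>dom_mult\<close> makes \<open>D g\<close> the preimage of \<open>D h\<close> under
    \<open>\<alpha> g\<close>.\<close>
  have Dg_closed: "\<alpha> g w \<in> D h" if "w \<in> D g" for w
  proof -
    have "w \<in> D (h \<otimes> g) \<inter> D g"
      using that P.dom_subset[OF g] P.dom_one hg by auto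
    then show ?thesis
      unfolding P.dom_mult[OF g h, symmetric] by simp
  qed
  \<comment> \<open>In Y, \<open>\<beta> h\<close> distributes over the product and cancels
    \<open>\<beta> g\<close> on the left factor. The fact serves both w = xy and w = y; the two
    results then differ only by bracketing.\<close>
  have shift: "\<alpha> g w \<otimes>\<^bsub>X\<^esub> z \<in> D h"
      "\<iota> (\<alpha> h (\<alpha> g w \<otimes>\<^bsub>X\<^esub> z)) = \<iota> w \<otimes>\<^bsub>Y\<^esub> \<beta> h (\<iota> z)" if w: "w \<in> D g" for w
  proof -
    show wz: "\<alpha> g w \<otimes>\<^bsub>X\<^esub> z \<in> D h"
      using Dh Dg_closed[OF w] z by (simp add: semigroup_ideal_def)
    have "\<iota> (\<alpha> h (\<alpha> g w \<otimes>\<^bsub>X\<^esub> z)) = \<beta> h (\<beta> g (\<iota> w) \<otimes>\<^bsub>Y\<^esub> \<iota> z)"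
      by (simp add: globalization_equivariant \<iota>_mult w z wz g h P.maps_to)
    also have "\<dots> = \<iota> w \<otimes>\<^bsub>Y\<^esub> \<beta> h (\<iota> z)"
      using w P.dom_subset[OF g] by (simp add: \<beta>h \<beta>hg \<iota>_in Q.maps_to z g subset_iff)
    finally show "\<iota> (\<alpha> h (\<alpha> g w \<otimes>\<^bsub>X\<^esub> z)) = \<iota> w \<otimes>\<^bsub>Y\<^esub> \<beta> h (\<iota> z)" .
  qed
  have xy: "x \<otimes>\<^bsub>X\<^esub> y \<in> D g"
    using Dg x y by (simp add: semigroup_ideal_def)
  have "\<iota> (\<alpha> h (\<alpha> g (x \<otimes>\<^bsub>X\<^esub> y) \<otimes>\<^bsub>X\<^esub> z)) = \<iota> (x \<otimes>\<^bsub>X\<^esub> \<alpha> h (\<alpha> g y \<otimes>\<^bsub>X\<^esub> z))"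
    by (simp add: shift xy x y y_in z h P.maps_to \<iota>_in Q.maps_to \<iota>_mult Y_assoc)
  then show ?thesis
    by (rule inj_onD[OF globalization_inj]) (simp_all add: shift(1) xy x y h P.maps_to X_closed)
qed

text \<open>Here \<open>k\<close> plays the zero, which enters through the absorption law
  \<open>k \<otimes> m = k\<close>.\<close>

lemma globalizable_LC2:
  assumes k: "k \<in> carrier M" and m: "m \<in> carrier M" and km: "k \<otimes> m = k"
    and x: "x \<in> carrier (adjoin_one X)" and y: "y \<in> D m" and z: "z \<in> carrier (adjoin_one X)"
    and u: "u \<in> D k" "x \<otimes>\<^bsub>adjoin_one X\<^esub> Some y \<otimes>\<^bsub>adjoin_one X\<^esub> z = Some u"
  shows "\<exists>v\<in>D k. x \<otimes>\<^bsub>adjoin_one X\<^esub> Some (\<alpha> m y) \<otimes>\<^bsub>adjoin_one X\<^esub> z = Some v \<and> \<alpha> k u = \<alpha> k v"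
proof -
  \<comment> \<open>On \<open>D k\<close> this is \<open>\<iota> \<circ> \<alpha> k\<close>, but it
    is a homomorphism on all of X, so it can be evaluated at \<open>v\<close> before
    \<open>v\<close> is known to lie in \<open>D k\<close>.\<close>
  define f where "f = \<beta> k \<circ> \<iota>"
  have "\<beta> k \<in> hom Y Y"
    using Q.act_hom[OF k] by simp
  then have f: "f \<in> hom X Y"
    unfolding f_def using globalization_hom by (rule hom_compose[rotated])
  note X_closed = sgroup_closed[OF P.semigroup_space]
  have y_in: "y \<in> carrier X" and \<alpha>y_in: "\<alpha> m y \<in> carrier X"
    using y P.dom_subset[OF m] P.maps_to[OF m] by auto
  have fy: "f (\<alpha> m y) = f y"
    using Q.act_mult[OF m k hom_in_carrier[OF globalization_hom y_in]]
      Q.maps_to[OF m hom_in_carrier[OF globalization_hom y_in]] km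
    by (simp add: f_def globalization_equivariant[OF m y])
  \<comment> \<open>The middle factor is tagged \<open>Some\<close>, hence so is the product. In
    each of the four cases (\<open>x\<close> and \<open>z\<close> adjoined identity or not),
    \<open>f\<close> is multiplicative and \<open>fy\<close> replaces the middle factor.\<close>
  obtain v where v: "x \<otimes>\<^bsub>adjoin_one X\<^esub> Some (\<alpha> m y) \<otimes>\<^bsub>adjoin_one X\<^esub> z = Some v"
      and v_in: "v \<in> carrier X" and "f v = f u"
    using x z u(2) y_in \<alpha>y_in X_closed
    by (auto simp: adjoin_one_def hom_mult[OF f] fy)
  then have "\<beta> k (\<iota> v) = \<iota> (\<alpha> k u)"
    using u(1) k by (simp add: f_def globalization_equivariant)
  then have "v \<in> D k \<and> \<alpha> k v = \<alpha> k u"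
    using globalization_reflects[OF k v_in P.maps_to[OF k u(1)]] by blast
  with v show ?thesis
    by auto
qed

end

theorem proposition3p12:
  fixes G :: "('g, 'c) monoid_scheme"
    and X :: "('x, 'b) monoid_scheme"
    and D :: "'g option \<Rightarrow> 'x set"
    and \<alpha> :: "'g option \<Rightarrow> 'x \<Rightarrow> 'x"
  assumes "group G"
    and "semigroup_strong_partial_action (adjoin_zero G) X D \<alpha>"
    and "\<forall>g\<in>carrier G. semigroup_ideal (D (Some g)) X"
    and "globalizable TYPE('y) (adjoin_zero G) X D \<alpha>"
  shows "LC1 G X D \<alpha> \<and> LC2 G X D \<alpha>"
proof -
  interpret group G
    by (fact assms(1))
  obtain Y :: "'y monoid" and \<beta> \<iota> where glob: "globalization (adjoin_zero G) X D \<alpha> Y \<beta> \<iota>"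
    using assms(4) by (auto simp: globalizable_def)
  have "LC1 G X D \<alpha>"
    unfolding LC1_def
  proof (intro ballI)
    fix g x y z
    assume g: "g \<in> carrier G" and xyz: "x \<in> carrier X" "y \<in> D (Some g)" "z \<in> carrier X"
    show "\<alpha> (Some (inv\<^bsub>G\<^esub> g)) (\<alpha> (Some g) (x \<otimes>\<^bsub>X\<^esub> y) \<otimes>\<^bsub>X\<^esub> z) =
        x \<otimes>\<^bsub>X\<^esub> \<alpha> (Some (inv\<^bsub>G\<^esub> g)) (\<alpha> (Some g) y \<otimes>\<^bsub>X\<^esub> z)"
      \<comment> \<open>Instance \<open>Some g\<close>, \<open>Some (inv g)\<close>: the inverse law
        of G carries over to the monoid with zero.\<close>
      by (rule globalizable_LC1[OF assms(2) glob _ _ _ _ _ xyz])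
        (simp_all add: adjoin_zero_def g assms(3))
  qed
  moreover have "LC2 G X D \<alpha>"
    unfolding LC2_def
  proof (intro ballI impI)
    fix m x y z u
    assume m: "m \<in> carrier (adjoin_zero G)" and y: "y \<in> D m"
      and x: "x \<in> carrier (adjoin_one X)" and z: "z \<in> carrier (adjoin_one X)"
      and u: "u \<in> D None" "x \<otimes>\<^bsub>adjoin_one X\<^esub> Some y \<otimes>\<^bsub>adjoin_one X\<^esub> z = Some u"
    show "\<exists>v\<in>D None. x \<otimes>\<^bsub>adjoin_one X\<^esub> Some (\<alpha> m y) \<otimes>\<^bsub>adjoin_one X\<^esub> z = Some v \<and>
        \<alpha> None u = \<alpha> None v"
      \<comment> \<open>With \<open>k\<close> = \<open>None\<close>, absorption holds for every
        \<open>m\<close>, the zero included.\<close>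
      by (rule globalizable_LC2[OF assms(2) glob _ m _ x y z u]) (simp_all add: adjoin_zero_def)
  qed
  ultimately show ?thesis ..
qed

end
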